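(* Let $t \ge 3$ be an integer and let $G$ be a connected graph that does not contain $K_t$ as an odd minor. Then there exist $\ell \in \mathbb{N}$ and pairwise vertex-disjoint connected induced subgraphs $H_1,\dots,H_\ell$ of $G$ with $V(H_1)\cup\cdots\cup V(H_\ell) = V(G)$ such that for every $i \in [\ell]$ the following hold: (1) $V(H_i)$ admits a partition into two disjoint sets $A_i, B_i$ such that every connected component of $G[A_i]$ and of $G[B_i]$ has at most $\lceil \frac{t-2}{2}\rceil$ vertices; (2) the spanning subgraph of $H_i$ whose edges are exactly the edges of $H_i$ with one endpoint in $A_i$ and the other in $B_i$ is connected; (3) every vertex $v \in V(G)\setminus (V(H_1)\cup\cdots\cup V(H_i))$ that is adjacent in $G$ to at least one vertex of $V(H_i)$ has a neighbor $a \in A_i$ and a neighbor $b\in B_i$; (4) for every connected component $C$ of $G - (V(H_1)\cup\cdots\cup V(H_i))$, at most $t-2$ of the subgraphs $H_1,\dots,H_i$ are adjacent to $G[C]$, and these subgraphs adjacent to $G[C]$ are pairwise adjacent to each other.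
   Context: All graphs are finite and simple; $[k]=\{1,\dots,k\}$. Two vertex-disjoint subgraphs $H, H'$ of $G$ are adjacent if some edge of $G$ has one endpoint in $V(H)$ and the other in $V(H')$. A connected component is regarded as a vertex set. For an integer $t\ge 1$, a $K_t$-expansion is a graph $F$ consisting of $t$ vertex-disjoint trees $T_1,\dots,T_t$ together with, for each pair of distinct trees, exactly one additional edge joining them. A $K_t$-expansion $F$ is odd if there is a $2$-coloring of $V(F)$ whose restriction to each tree $T_s$ is a proper coloring of $T_s$, while every edge joining two distinct trees has both endpoints of the same color. A graph $G$ contains $K_t$ as an odd minor if some subgraph of $G$ is an odd $K_t$-expansion. *)

theory Defs
  imports Complex_Main
begin

definition sgraph :: "'a set \<Rightarrow> ('a \<Rightarrow> 'a \<Rightarrow> bool) \<Rightarrow> bool" where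
  "sgraph V E \<longleftrightarrow> finite V \<and> (\<forall>u v. E u v \<longrightarrow> u \<in> V \<and> v \<in> V)
     \<and> (\<forall>u v. E u v \<longrightarrow> E v u) \<and> (\<forall>u. \<not> E u u)"

definition reach :: "('a \<Rightarrow> 'a \<Rightarrow> bool) \<Rightarrow> 'a set \<Rightarrow> 'a \<Rightarrow> 'a \<Rightarrow> bool" where
  "reach R S u v \<longleftrightarrow> (\<lambda>x y. R x y \<and> x \<in> S \<and> y \<in> S)\<^sup>*\<^sup>* u v"

definition conn :: "('a \<Rightarrow> 'a \<Rightarrow> bool) \<Rightarrow> 'a set \<Rightarrow> bool" where
  "conn R S \<longleftrightarrow> S \<noteq> {} \<and> (\<forall>u\<in>S. \<forall>v\<in>S. reach R S u v)"

definition component :: "('a \<Rightarrow> 'a \<Rightarrow> bool) \<Rightarrow> 'a set \<Rightarrow> 'a set \<Rightarrow> bool" where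
  "component E X C \<longleftrightarrow> C \<subseteq> X \<and> conn E C \<and> (\<forall>u\<in>C. \<forall>v\<in>X. E u v \<longrightarrow> v \<in> C)"

definition adj :: "('a \<Rightarrow> 'a \<Rightarrow> bool) \<Rightarrow> 'a set \<Rightarrow> 'a set \<Rightarrow> bool" where
  "adj E S T \<longleftrightarrow> (\<exists>u\<in>S. \<exists>v\<in>T. E u v)"

text \<open>(X, F) is a tree subgraph of G: F consists of edges of G inside X, it is connected,
  and acyclic (no edge lies on a cycle: removing it disconnects its endpoints).\<close>
definition tree_sub :: "('a \<Rightarrow> 'a \<Rightarrow> bool) \<Rightarrow> 'a set \<Rightarrow> 'a set set \<Rightarrow> bool" where
  "tree_sub E X F \<longleftrightarrow>
     (\<forall>e\<in>F. \<exists>u v. e = {u, v} \<and> E u v \<and> u \<in> X \<and> v \<in> X)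
   \<and> conn (\<lambda>x y. {x, y} \<in> F) X
   \<and> (\<forall>u v. {u, v} \<in> F \<longrightarrow> \<not> reach (\<lambda>x y. {x, y} \<in> F - {{u, v}}) X u v)"

text \<open>G contains K_t as an odd minor: some subgraph of G is an odd K_t-expansion.
  Trees X s (edge sets F s), s = 1..t, pairwise vertex-disjoint; for s < s' the edge
  p s s' of G joins tree s and tree s'; c is a 2-colouring proper on every tree and
  monochromatic on every joining edge.\<close>
definition odd_minor :: "'a set \<Rightarrow> ('a \<Rightarrow> 'a \<Rightarrow> bool) \<Rightarrow> nat \<Rightarrow> bool" where
  "odd_minor V E t \<longleftrightarrow>
    (\<exists>(X :: nat \<Rightarrow> 'a set) (F :: nat \<Rightarrow> 'a set set) (p :: nat \<Rightarrow> nat \<Rightarrow> 'a \<times> 'a) (c :: 'a \<Rightarrow> bool).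
       (\<forall>s\<in>{1..t}. X s \<subseteq> V \<and> tree_sub E (X s) (F s)
                    \<and> (\<forall>u v. {u, v} \<in> F s \<longrightarrow> c u \<noteq> c v))
     \<and> (\<forall>s\<in>{1..t}. \<forall>s'\<in>{1..t}. s \<noteq> s' \<longrightarrow> X s \<inter> X s' = {})
     \<and> (\<forall>s\<in>{1..t}. \<forall>s'\<in>{1..t}. s < s' \<longrightarrow>
          fst (p s s') \<in> X s \<and> snd (p s s') \<in> X s' \<and> E (fst (p s s')) (snd (p s s'))
          \<and> c (fst (p s s')) = c (snd (p s s'))))"

end

theory Submission
  imports Defs "HOL-Library.Infinite_Set"
begin

text \<open>The pieces are chosen greedily. Given a component \<open>C\<close> of what remains, take a minimal connected
  set in \<open>C\<close> meeting the neighbourhood of every earlier piece adjacent to \<open>C\<close>. A minimal connected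
  set through \<open>k\<close> vertices has a connected cut whose monochromatic components have at most
  \<open>\<lceil>k / 2\<rceil>\<close> vertices. As long as some remaining vertex of \<open>C\<close> has neighbours in only one class,
  put it into the other class, where it is isolated; this yields property (3). Property (3) also
  provides a monochromatic edge between any two adjacent pieces, whichever way the pieces are
  coloured, so \<open>t - 1\<close> pairwise adjacent pieces together with a component adjacent to all of them
  would contain \<open>K\<^sub>t\<close> as an odd minor.\<close>

section \<open>Connectivity\<close>

lemma reach_refl: "reach R S u u"
  by (simp add: reach_def)

lemma reach_step: "reach R S u v \<Longrightarrow> R v w \<Longrightarrow> v \<in> S \<Longrightarrow> w \<in> S \<Longrightarrow> reach R S u w"
  unfolding reach_def by (rule rtranclp.rtrancl_into_rtrancl) auto

lemma reach_trans: "reach R S u v \<Longrightarrow> reach R S v w \<Longrightarrow> reach R S u w"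
  unfolding reach_def by (rule rtranclp_trans)

lemma reach_mono:
  assumes "reach R S u v" and "S \<subseteq> T" and "\<And>x y. x \<in> S \<Longrightarrow> y \<in> S \<Longrightarrow> R x y \<Longrightarrow> Q x y"
  shows "reach Q T u v"
  using assms(1) unfolding reach_def
  by (rule rtranclp_mono[THEN predicate2D, rotated]) (use assms in auto)

lemma reach_sym:
  assumes "reach R S u v" and "symp R"
  shows "reach R S v u"
proof -
  have "symp (\<lambda>x y. R x y \<and> x \<in> S \<and> y \<in> S)"
    using assms(2) by (auto simp: symp_def)
  then show ?thesis
    using assms(1) unfolding reach_def by (metis symp_rtranclp sympD)
qed

lemma conn_singleton: "conn R {x}"
  by (simp add: conn_def reach_refl)

lemma conn_mono_rel:
  assumes "conn R S" and "\<And>x y. x \<in> S \<Longrightarrow> y \<in> S \<Longrightarrow> R x y \<Longrightarrow> Q x y"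
  shows "conn Q S"
  using assms reach_mono[of R S _ _ S Q] unfolding conn_def by blast

lemma conn_from_root:
  assumes "w \<in> S" and "symp R" and "\<And>u. u \<in> S \<Longrightarrow> reach R S w u"
  shows "conn R S"
  using assms reach_sym reach_trans unfolding conn_def by (metis empty_iff)

lemma conn_Un:
  assumes "conn R S" and "conn R T" and "w \<in> S" and "w \<in> T"
  shows "conn R (S \<union> T)"
proof -
  have "reach R (S \<union> T) u w \<and> reach R (S \<union> T) w u" if "u \<in> S \<union> T" for u
    using that assms reach_mono[of R S _ _ "S \<union> T" R] reach_mono[of R T _ _ "S \<union> T" R]
    unfolding conn_def by blast
  then show ?thesis
    using assms reach_trans unfolding conn_def by (metis UnI1 empty_iff)
qed

lemma conn_insert:
  assumes "conn R S" and "symp R" and "y \<in> S" and "R x y"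
  shows "conn R (insert x S)"
proof (rule conn_from_root)
  fix u assume "u \<in> insert x S"
  moreover have "reach R (insert x S) y u" if "u \<in> S"
    using assms that reach_mono[of R S y u "insert x S" R] unfolding conn_def by blast
  moreover have "reach R (insert x S) y x"
    using assms by (intro reach_step[OF reach_refl]) (auto dest: sympD)
  ultimately show "reach R (insert x S) y u" by auto
qed (use assms in auto)

text \<open>On a path from a vertex of \<open>X\<close> to one outside, some step leaves
  \<open>X\<close>. Connectivity is mostly used in this form, to refute that a connected set meets
  two parts with no edge between them.\<close>

lemma conn_exit:
  assumes "conn R S" and "X \<subseteq> S" and "X \<noteq> {}" and "X \<noteq> S"
  obtains x y where "x \<in> X" and "y \<in> S - X" and "R x y"
proof -
  obtain u v where uv: "u \<in> X" "v \<in> S" "v \<notin> X" using assms by blast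
  then have "reach R S u v" using assms unfolding conn_def by blast
  then have "v \<notin> X \<longrightarrow> (\<exists>x\<in>X. \<exists>y\<in>S - X. R x y)"
    unfolding reach_def
    by (induction rule: rtranclp_induct) (use uv in auto)
  then show ?thesis using uv that by blast
qed

lemma not_conn_split:
  assumes "\<not> conn R S" and "S \<noteq> {}" and "symp R"
  obtains D where "D \<subseteq> S" and "D \<noteq> {}" and "D \<noteq> S" and "\<And>x y. x \<in> D \<Longrightarrow> y \<in> S - D \<Longrightarrow> \<not> R x y"
proof -
  obtain u where u: "u \<in> S" using assms by blast
  let ?D = "{x \<in> S. reach R S u x}"
  have "?D \<noteq> S"
  proof
    assume "?D = S"
    then have "conn R S" using conn_from_root[OF u assms(3)] by blast
    then show False using assms by blast
  qed
  moreover have "u \<in> ?D" using u by (simp add: reach_refl)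
  moreover have "\<not> R x y" if "x \<in> ?D" "y \<in> S - ?D" for x y
    using that reach_step[of R S u x y] by auto
  ultimately show ?thesis by (intro that[of ?D]) auto
qed

text \<open>A path in \<open>C\<close> starting at \<open>w\<close> can return from
  \<open>G'\<close> into \<open>G\<close> only through \<open>w\<close>, so dropping its excursions
  leaves a path inside \<open>C \<inter> G\<close>. Hence a connected set through a cut vertex
  splits into two connected sets sharing that vertex.\<close>

lemma conn_piece:
  assumes "conn R C" and "symp R" and "w \<in> C" and "C \<subseteq> G \<union> G'" and "G \<inter> G' = {w}"
    and no_edge: "\<And>x y. x \<in> G - {w} \<Longrightarrow> y \<in> G' - {w} \<Longrightarrow> \<not> R x y"
  shows "conn R (C \<inter> G)"
proof (rule conn_from_root)
  fix u assume u: "u \<in> C \<inter> G"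
  then have "reach R C w u" using assms unfolding conn_def by blast
  \<comment> \<open>Path vertices outside \<open>G\<close> carry no claim, hence the implication as
    induction invariant.\<close>
  then have "u \<in> G \<longrightarrow> reach R (C \<inter> G) w u"
    unfolding reach_def[of R C]
  proof (induction rule: rtranclp_induct)
    case base
    then show ?case by (simp add: reach_refl)
  next
    case (step y z)
    show ?case
    proof (cases "y \<in> G \<or> z = w")
      case True
      then show ?thesis using step reach_step[of R "C \<inter> G" w y z] by (auto simp: reach_refl)
    next
      case False
      then have "y \<in> G' - {w}" using step assms by auto
      then show ?thesis using False no_edge[of z y] step assms(2) by (auto dest: sympD)
    qed
  qed
  then show "reach R (C \<inter> G) w u" using u by blast
qed (use assms in auto)

section \<open>Connected components\<close>

lemma component_exists:
  assumes "x \<in> W" and "symp E"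
  obtains C where "component E W C" and "x \<in> C"
proof -
  define C where "C = {y \<in> W. reach E W x y}"
  have "conn E C"
  proof (rule conn_from_root)
    fix u assume "u \<in> C"
    then have "reach E W x u" by (simp add: C_def)
    then show "reach E C x u" unfolding reach_def[of E W]
    proof (induction rule: rtranclp_induct)
      case base
      then show ?case by (simp add: reach_refl)
    next
      case (step y z)
      then have "reach E W x y" "reach E W x z"
        unfolding reach_def by (auto intro: rtranclp.rtrancl_into_rtrancl)
      then show ?case using step by (intro reach_step[of E C x y z]) (auto simp: C_def)
    qed
  qed (use assms in \<open>auto simp: reach_refl C_def\<close>)
  moreover have "v \<in> C" if "u \<in> C" "v \<in> W" "E u v" for u v
    using that reach_step[of E W x u v] by (auto simp: C_def)
  ultimately have "component E W C" unfolding component_def C_def by blast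
  moreover have "x \<in> C" using assms by (simp add: C_def reach_refl)
  ultimately show ?thesis using that by blast
qed

lemma conn_subset_component:
  assumes "component E W C" and "conn E D" and "D \<subseteq> W" and "x \<in> C" and "x \<in> D"
  shows "D \<subseteq> C"
proof (rule ccontr)
  assume "\<not> D \<subseteq> C"
  then obtain u v where "u \<in> D \<inter> C" "v \<in> D - D \<inter> C" "E u v"
    using conn_exit[OF assms(2), of "D \<inter> C"] assms by blast
  then show False using assms unfolding component_def by blast
qed

section \<open>Connected cuts with small monochromatic components\<close>

definition cut_edge :: "('a \<Rightarrow> 'a \<Rightarrow> bool) \<Rightarrow> 'a set \<Rightarrow> 'a set \<Rightarrow> 'a \<Rightarrow> 'a \<Rightarrow> bool" where
  "cut_edge E A B = (\<lambda>x y. E x y \<and> (x \<in> A \<and> y \<in> B \<or> x \<in> B \<and> y \<in> A))"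

text \<open>Bounding every connected subset, not only the components, spares identifying maximal
  sets when classes grow or are merged; for finite \<open>X\<close> and symmetric \<open>E\<close>
  the condition is the same.\<close>

definition conn_le :: "('a \<Rightarrow> 'a \<Rightarrow> bool) \<Rightarrow> 'a set \<Rightarrow> nat \<Rightarrow> bool" where
  "conn_le E X m \<longleftrightarrow> (\<forall>C. conn E C \<longrightarrow> C \<subseteq> X \<longrightarrow> card C \<le> m)"

lemma cut_edge_commute: "cut_edge E A B = cut_edge E B A"
  unfolding cut_edge_def by blast

lemma symp_cut_edge: "symp E \<Longrightarrow> symp (cut_edge E A B)"
  unfolding cut_edge_def symp_def by blast

lemma cut_edge_mono: "cut_edge E A B x y \<Longrightarrow> A \<subseteq> A' \<Longrightarrow> B \<subseteq> B' \<Longrightarrow> cut_edge E A' B' x y"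
  unfolding cut_edge_def by blast

lemma conn_cut_conn: "conn (cut_edge E A B) X \<Longrightarrow> conn E X"
  by (erule conn_mono_rel) (simp add: cut_edge_def)

lemma conn_cut_insert:
  assumes "conn (cut_edge E A B) (A \<union> B)" and "symp E" and "a \<in> A" and "E y a"
  shows "conn (cut_edge E A (insert y B)) (A \<union> insert y B)"
proof -
  have "conn (cut_edge E A (insert y B)) (A \<union> B)"
    using assms(1) by (rule conn_mono_rel) (auto elim: cut_edge_mono)
  then have "conn (cut_edge E A (insert y B)) (insert y (A \<union> B))"
    by (rule conn_insert[OF _ symp_cut_edge[OF assms(2)], of _ _ _ a]) (use assms in \<open>auto simp: cut_edge_def\<close>)
  then show ?thesis by simp
qed

lemma conn_le_mono: "conn_le E X m \<Longrightarrow> m \<le> n \<Longrightarrow> conn_le E X n"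
  unfolding conn_le_def using le_trans by blast

lemma conn_le_card: "finite X \<Longrightarrow> conn_le E X (card X)"
  unfolding conn_le_def by (simp add: card_mono)

text \<open>A connected set containing the new vertex can only be the singleton, which
  \<open>1 \<le> m\<close> permits.\<close>

lemma conn_le_insert_isolated:
  assumes "conn_le E X m" and "1 \<le> m" and "\<And>x. x \<in> X \<Longrightarrow> \<not> E y x"
  shows "conn_le E (insert y X) m"
  unfolding conn_le_def
proof (intro allI impI)
  fix C assume C: "conn E C" "C \<subseteq> insert y X"
  show "card C \<le> m"
  proof (cases "y \<in> C")
    case True
    have "C = {y}"
    proof (rule ccontr)
      assume "C \<noteq> {y}"
      then obtain x z where "x \<in> {y}" "z \<in> C - {y}" "E x z"
        using conn_exit[OF C(1), of "{y}"] True by blast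
      then show False using C assms(3) by blast
    qed
    then show ?thesis using assms by simp
  next
    case False
    then show ?thesis using C assms unfolding conn_le_def by blast
  qed
qed

text \<open>Grow the two classes from \<open>v\<close>: a new vertex with neighbours in one class only joins the
  other class as an isolated vertex, and a new vertex with neighbours in both joins the smaller class.\<close>
lemma balanced_connected_cut:
  assumes "finite S" and "conn E S" and "symp E" and "v \<in> S" and "2 \<le> card S"
  obtains A B where "A \<union> B = S" and "A \<inter> B = {}" and "v \<in> A" and "conn (cut_edge E A B) S"
    and "conn_le E A (card S div 2)" and "conn_le E B ((card S + 1) div 2)"
proof -
  have "\<exists>A B. A \<union> B \<subseteq> S \<and> card (A \<union> B) = n \<and> A \<inter> B = {} \<and> v \<in> A \<and> conn (cut_edge E A B) (A \<union> B)
      \<and> conn_le E A (n div 2) \<and> conn_le E B ((n + 1) div 2)"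
    if "2 \<le> n" "n \<le> card S" for n
    using that
  proof (induction n rule: dec_induct)
    \<comment> \<open>Growth starts at two vertices because \<open>1 div 2 = 0\<close> would leave
      no room for \<open>v\<close>; at \<open>n = 2\<close> both bounds equal 1.\<close>
    case base
    have "S \<noteq> {v}" using assms by auto
    then obtain x u where "x \<in> {v}" "u \<in> S - {v}" "E x u"
      using conn_exit[OF assms(2), of "{v}"] assms by blast
    then have u: "u \<in> S" "u \<noteq> v" "E v u" by auto
    have "conn (cut_edge E {v} {u}) ({v} \<union> {u})"
      using conn_cut_insert[of E "{v}" "{}" v u] u assms(3) by (auto simp: conn_singleton dest: sympD)
    moreover have "conn_le E {v} 1" "conn_le E {u} 1"
      using conn_le_card[of "{v}" E] conn_le_card[of "{u}" E] by simp_all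
    ultimately show ?case using u assms by (intro exI[of _ "{v}"] exI[of _ "{u}"]) simp
  next
    case (step n)
    then obtain A B where AB: "A \<union> B \<subseteq> S" "card (A \<union> B) = n" "A \<inter> B = {}" "v \<in> A"
      "conn (cut_edge E A B) (A \<union> B)" "conn_le E A (n div 2)" "conn_le E B ((n + 1) div 2)" by auto
    have fin: "finite A" "finite B" using AB(1) assms(1) by (auto intro: finite_subset)
    have n: "card A + card B = n" using AB(2,3) fin by (simp add: card_Un_disjoint)
    obtain x y where xy: "x \<in> A \<union> B" "y \<in> S - (A \<union> B)" "E x y"
    proof -
      have "A \<union> B \<noteq> S" using AB(2) step.prems by auto
      then show ?thesis using conn_exit[OF assms(2) AB(1)] AB(4) that by blast
    qed
    have addA: ?case if "b \<in> B" "E y b" "conn_le E (insert y A) (Suc n div 2)" for b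
    proof -
      have "conn (cut_edge E (insert y A) B) (insert y A \<union> B)"
        using conn_cut_insert[of E B A b y] that AB(5) assms(3) by (simp add: cut_edge_commute Un_commute)
      moreover have "conn_le E B ((Suc n + 1) div 2)" using AB(7) by (rule conn_le_mono) simp
      ultimately show ?thesis using that AB xy fin
        by (intro exI[of _ "insert y A"] exI[of _ B]) auto
    qed
    have addB: ?case if "a \<in> A" "E y a" "conn_le E (insert y B) ((Suc n + 1) div 2)" for a
    proof -
      have "conn (cut_edge E A (insert y B)) (A \<union> insert y B)"
        using conn_cut_insert[of E A B a y] that AB(5) assms(3) by simp
      moreover have "conn_le E A (Suc n div 2)" using AB(6) by (rule conn_le_mono) simp
      ultimately show ?thesis using that AB xy fin
        by (intro exI[of _ A] exI[of _ "insert y B"]) auto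
    qed
    have yx: "E y x" using xy assms(3) by (auto dest: sympD)
    consider (A) b where "b \<in> B" "E y b" "\<And>a. a \<in> A \<Longrightarrow> \<not> E y a"
      | (B) a where "a \<in> A" "E y a" "\<And>b. b \<in> B \<Longrightarrow> \<not> E y b"
      | (both) a b where "a \<in> A" "E y a" "b \<in> B" "E y b"
      using yx xy by blast
    then show ?case
    proof cases
      case A
      have "conn_le E A (Suc n div 2)" using AB(6) by (rule conn_le_mono) simp
      then show ?thesis using A step.hyps by (intro addA conn_le_insert_isolated) auto
    next
      case B
      have "conn_le E B ((Suc n + 1) div 2)" using AB(7) by (rule conn_le_mono) simp
      then show ?thesis using B step.hyps by (intro addB conn_le_insert_isolated) auto
    next
      case both
      show ?thesis
      \<comment> \<open>The trivial bound by cardinality suffices here. If \<open>A\<close> is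
        smaller, then \<open>2 * card A + 1 \<le> n\<close>; otherwise
        \<open>2 * card B \<le> n\<close>, so a tie goes to \<open>B\<close>, whose bound is the one
        rounded up.\<close>
      proof (cases "card A < card B")
        case True
        have "conn_le E (insert y A) (Suc n div 2)"
          by (rule conn_le_mono[OF conn_le_card]) (use fin True n xy in auto)
        then show ?thesis using addA both by blast
      next
        case False
        have "conn_le E (insert y B) ((Suc n + 1) div 2)"
          by (rule conn_le_mono[OF conn_le_card]) (use fin False n xy in auto)
        then show ?thesis using addB both by blast
      qed
    qed
  qed
  from this[OF assms(5) order_refl] obtain A B where AB: "A \<union> B \<subseteq> S" "card (A \<union> B) = card S"
    "A \<inter> B = {}" "v \<in> A" "conn (cut_edge E A B) (A \<union> B)"
    "conn_le E A (card S div 2)" "conn_le E B ((card S + 1) div 2)" by blast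
  then have "A \<union> B = S" using assms(1) card_subset_eq by blast
  then show ?thesis using AB that by metis
qed

text \<open>Serves the last branch set of an odd clique minor, where the sizes of monochromatic sets
  are irrelevant.\<close>

lemma connected_cut_exists:
  assumes "finite S" and "conn E S" and "symp E"
  obtains A B where "A \<union> B = S" and "A \<inter> B = {}" and "conn (cut_edge E A B) S"
proof (cases "2 \<le> card S")
  case True
  obtain v where "v \<in> S" using assms unfolding conn_def by blast
  then show ?thesis using balanced_connected_cut[OF assms _ True] that by metis
next
  case False
  then obtain v where "S = {v}" using assms unfolding conn_def
    by (metis One_nat_def card_1_singletonE card_gt_0_iff less_2_cases not_le order.strict_iff_not)
  then show ?thesis using that[of "{v}" "{}"] by (simp add: conn_singleton)
qed

section \<open>Cuts of minimal connected sets\<close>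

lemma split_at_cut_vertex:
  assumes "conn E H" and "symp E" and "w \<in> H" and "v \<in> H" and "H - {w} \<noteq> {}" and "\<not> conn E (H - {w})"
  obtains G G' where "G \<union> G' = H" and "G \<inter> G' = {w}" and "v \<in> G" and "G \<noteq> {w}" and "G' \<noteq> {w}"
    and "\<And>x y. x \<in> G - {w} \<Longrightarrow> y \<in> G' - {w} \<Longrightarrow> \<not> E x y" and "conn E G" and "conn E G'"
proof -
  obtain D where D: "D \<subseteq> H - {w}" "D \<noteq> {}" "D \<noteq> H - {w}"
    and no_edge: "\<And>x y. x \<in> D \<Longrightarrow> y \<in> H - {w} - D \<Longrightarrow> \<not> E x y"
    using not_conn_split[OF assms(6,5,2)] by blast
  have no_edge': "\<not> E y x" if "x \<in> D" "y \<in> H - {w} - D" for x y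
    using no_edge[OF that] assms(2) by (auto dest: sympD)
  \<comment> \<open>\<open>D\<close> has no edge to the rest of \<open>H - {w}\<close>, so adding
    \<open>w\<close> to both sides gives pieces that meet only in \<open>w\<close>; they are
    exchanged below when \<open>v\<close> is not in the first.\<close>
  let ?G = "insert w D" and ?G' = "H - D"
  have "conn E (H \<inter> ?G)" by (rule conn_piece[of E H w _ ?G']) (use assms D no_edge in auto)
  moreover have "H \<inter> ?G = ?G" using D assms by blast
  moreover have "conn E (H \<inter> ?G')" by (rule conn_piece[of E H w _ ?G]) (use assms D no_edge' in auto)
  moreover have "H \<inter> ?G' = ?G'" by blast
  ultimately have conn: "conn E ?G" "conn E ?G'" by simp_all
  show ?thesis
  proof (cases "v \<in> ?G")
    case True
    show ?thesis by (rule that[of ?G ?G']) (use True D assms conn no_edge in auto)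
  next
    case False
    show ?thesis by (rule that[of ?G' ?G]) (use False D assms conn no_edge' in auto)
  qed
qed

text \<open>The two halves at a cut vertex \<open>w\<close> are coloured separately, the second one rooted at \<open>w\<close>;
  the sharper bound at the root absorbs the rounding when monochromatic sets are merged at \<open>w\<close>.
  Without a cut vertex, minimality forces \<open>H = S\<close>.\<close>
lemma minimal_connected_cut:
  assumes "finite H" and "conn E H" and "symp E" and "S \<subseteq> H" and "v \<in> S" and "2 \<le> card S"
    and "\<And>H'. S \<subseteq> H' \<Longrightarrow> H' \<subseteq> H \<Longrightarrow> conn E H' \<Longrightarrow> H' = H"
  shows "\<exists>A B. A \<union> B = H \<and> A \<inter> B = {} \<and> conn (cut_edge E A B) H
    \<and> (\<forall>C. conn E C \<longrightarrow> C \<subseteq> A \<or> C \<subseteq> B \<longrightarrow>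
         card C \<le> (card S + 1) div 2 \<and> (v \<in> C \<longrightarrow> card C \<le> card S div 2))"
  using assms
proof (induction "card H" arbitrary: H S v rule: less_induct)
  case less
  note finH = \<open>finite H\<close> and connH = \<open>conn E H\<close> and sym = \<open>symp E\<close> and SH = \<open>S \<subseteq> H\<close>
    and vS = \<open>v \<in> S\<close> and min = less.prems(7)
  show ?case
  proof (cases "\<exists>w\<in>H. H - {w} \<noteq> {} \<and> \<not> conn E (H - {w})")
    case False
    \<comment> \<open>Deleting a vertex outside \<open>S\<close> would leave a smaller connected
      superset of \<open>S\<close>.\<close>
    have "S = H"
    proof (rule ccontr)
      assume "S \<noteq> H"
      then obtain x where x: "x \<in> H" "x \<notin> S" using SH by blast
      then have "H - {x} \<noteq> {}" using vS SH by auto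
      then have "conn E (H - {x})" using False x(1) by blast
      then have "H - {x} = H" using x SH by (intro min) auto
      then show False using x by blast
    qed
    then obtain A B where AB: "A \<union> B = H" "A \<inter> B = {}" "v \<in> A" "conn (cut_edge E A B) H"
      "conn_le E A (card S div 2)" "conn_le E B ((card S + 1) div 2)"
    proof -
      have "v \<in> H" "2 \<le> card H" using vS less.prems(6) \<open>S = H\<close> by auto
      then show ?thesis
        using balanced_connected_cut[OF finH connH sym] that \<open>S = H\<close> by blast
    qed
    have "conn_le E A ((card S + 1) div 2)" using AB(5) by (rule conn_le_mono) simp
    then show ?thesis using AB unfolding conn_le_def by (intro exI[of _ A] exI[of _ B]) blast
  next
    case True
    then obtain w where w: "w \<in> H" "H - {w} \<noteq> {}" "\<not> conn E (H - {w})" by blast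
    obtain G G' where G: "G \<union> G' = H" "G \<inter> G' = {w}" "v \<in> G" "G \<noteq> {w}" "G' \<noteq> {w}"
      and no_edge: "\<And>x y. x \<in> G - {w} \<Longrightarrow> y \<in> G' - {w} \<Longrightarrow> \<not> E x y"
      and conG: "conn E G" "conn E G'"
      using split_at_cut_vertex[OF connH sym w(1) _ w(2,3), of v] vS SH by blast
    have no_edge': "\<not> E y x" if "x \<in> G - {w}" "y \<in> G' - {w}" for x y
      using no_edge[OF that] sym by (auto dest: sympD)
    have finG: "finite G" "finite G'" using G finH by auto
    have finS: "finite S" using SH finH finite_subset by blast
    \<comment> \<open>The cut vertex becomes an extra terminal on each side; with it, each half is
      again a minimal connected set through its terminals.\<close>
    define T where "T = insert w (S \<inter> G)"
    define T' where "T' = insert w (S \<inter> G')"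
    have finT: "finite T" "finite T'" unfolding T_def T'_def using finS by auto
    have "card T + card T' = card (T \<union> T') + card (T \<inter> T')"
      using finT by (rule card_Un_Int)
    moreover have "T \<union> T' = insert w S" "T \<inter> T' = {w}"
      unfolding T_def T'_def using G SH by auto
    \<comment> \<open>\<open>w\<close> is counted in both sets and possibly not in \<open>S\<close>,
      which costs at most two.\<close>
    ultimately have cardT: "card T + card T' \<le> card S + 2"
      using card_insert_le_m1[of "card S + 1" S w] by (simp add: card_insert_if finS)
    \<comment> \<open>If one half had no vertex of \<open>S\<close> other than possibly
      \<open>w\<close>, the other half alone would be connected and contain \<open>S\<close>,
      against minimality.\<close>
    have two: "2 \<le> card (insert w (S \<inter> K))"
      if "K \<union> L = H" "K \<inter> L = {w}" "K \<noteq> {w}" "conn E L" for K L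
    proof (rule ccontr)
      assume *: "\<not> 2 \<le> card (insert w (S \<inter> K))"
      have "card (insert w (S \<inter> K)) = Suc (card (S \<inter> K - {w}))"
        using finS by (simp add: card.insert_remove)
      then have "card (S \<inter> K - {w}) = 0" using * by linarith
      then have "S \<inter> K \<subseteq> {w}" using finS by auto
      then have "L = H" using that SH by (intro min) auto
      then show False using that by blast
    qed
    have two_T: "2 \<le> card T" "2 \<le> card T'"
      unfolding T_def T'_def using two[of G G'] two[of G' G] G conG by auto
    \<comment> \<open>Glue a smaller candidate \<open>K'\<close> to the full other half at
      \<open>w\<close>: the union is connected and contains \<open>S\<close>, so it is
      \<open>H\<close>, which forces \<open>K' = K\<close>.\<close>
    have min_half: "K' = K" if "K \<union> L = H" "K \<inter> L = {w}" "conn E L" "insert w (S \<inter> K) \<subseteq> K'"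
      "K' \<subseteq> K" "conn E K'" for K L K'
    proof -
      have "K' \<union> L = H"
        using that SH by (intro min conn_Un[of E K' L w]) auto
      then show ?thesis using that by blast
    qed
    have "G \<subset> H" "G' \<subset> H" using G by blast+
    then have lt: "card G < card H" "card G' < card H" using finH psubset_card_mono by auto
    obtain A B where AB: "A \<union> B = G" "A \<inter> B = {}" "conn (cut_edge E A B) G"
      and boundG: "\<And>C. conn E C \<Longrightarrow> C \<subseteq> A \<or> C \<subseteq> B \<Longrightarrow>
        card C \<le> (card T + 1) div 2 \<and> (v \<in> C \<longrightarrow> card C \<le> card T div 2)"
    proof -
      have "\<exists>A B. A \<union> B = G \<and> A \<inter> B = {} \<and> conn (cut_edge E A B) G
        \<and> (\<forall>C. conn E C \<longrightarrow> C \<subseteq> A \<or> C \<subseteq> B \<longrightarrow>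
          card C \<le> (card T + 1) div 2 \<and> (v \<in> C \<longrightarrow> card C \<le> card T div 2))"
        by (rule less.hyps[OF lt(1) finG(1) conG(1) sym])
          (use G vS two_T min_half[OF G(1,2) conG(2)] in \<open>auto simp: T_def\<close>)
      then show ?thesis using that by blast
    qed
    obtain P Q where PQ: "P \<union> Q = G'" "P \<inter> Q = {}" "conn (cut_edge E P Q) G'" "w \<in> A \<longleftrightarrow> w \<in> P"
      and boundG': "\<And>C. conn E C \<Longrightarrow> C \<subseteq> P \<or> C \<subseteq> Q \<Longrightarrow>
        card C \<le> (card T' + 1) div 2 \<and> (w \<in> C \<longrightarrow> card C \<le> card T' div 2)"
    proof -
      have G'G: "G' \<union> G = H" "G' \<inter> G = {w}" using G by auto
      have "\<exists>A B. A \<union> B = G' \<and> A \<inter> B = {} \<and> conn (cut_edge E A B) G'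
        \<and> (\<forall>C. conn E C \<longrightarrow> C \<subseteq> A \<or> C \<subseteq> B \<longrightarrow>
          card C \<le> (card T' + 1) div 2 \<and> (w \<in> C \<longrightarrow> card C \<le> card T' div 2))"
        by (rule less.hyps[OF lt(2) finG(2) conG(2) sym])
          (use G two_T min_half[OF G'G conG(1)] in \<open>auto simp: T'_def\<close>)
      then obtain P Q where *: "P \<union> Q = G'" "P \<inter> Q = {}" "conn (cut_edge E P Q) G'"
        "\<And>C. conn E C \<Longrightarrow> C \<subseteq> P \<or> C \<subseteq> Q \<Longrightarrow>
          card C \<le> (card T' + 1) div 2 \<and> (w \<in> C \<longrightarrow> card C \<le> card T' div 2)" by blast
      show ?thesis
      \<comment> \<open>The classes of the second half are exchanged if necessary, so that both cuts
        put \<open>w\<close> on the same side; its rounded-down bound holds for whichever class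
        contains \<open>w\<close>.\<close>
      proof (cases "w \<in> A \<longleftrightarrow> w \<in> P")
        case True
        then show ?thesis using * that[of P Q] by blast
      next
        case False
        have "w \<in> G'" using G by blast
        then have "w \<in> A \<longleftrightarrow> w \<in> Q" using False *(1,2) by blast
        then show ?thesis using * that[of Q P] by (simp add: Un_commute Int_commute cut_edge_commute disj_commute)
      qed
    qed
    have wGG: "w \<in> G" "w \<in> G'" using G by auto
    have "conn (cut_edge E (A \<union> P) (B \<union> Q)) (G \<union> G')"
      by (rule conn_Un[OF conn_mono_rel[OF AB(3)] conn_mono_rel[OF PQ(3)], of _ w])
        (use wGG in \<open>auto elim: cut_edge_mono\<close>)
    then have conn_cut: "conn (cut_edge E (A \<union> P) (B \<union> Q)) H" using G by simp
    have disj: "(A \<union> P) \<inter> (B \<union> Q) = {}"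
      using AB(1,2) PQ(1,2,4) G(2) by blast
    have bound: "card C \<le> (card S + 1) div 2 \<and> (v \<in> C \<longrightarrow> card C \<le> card S div 2)"
      if C: "conn E C" "C \<subseteq> A \<union> P \<or> C \<subseteq> B \<union> Q" for C
    proof -
      have CH: "C \<subseteq> G \<union> G'" using C AB PQ by blast
      have CG: "C \<inter> G \<subseteq> A \<or> C \<inter> G \<subseteq> B"
        using C(2) AB(1,2) PQ(1,2,4) G(2) by blast
      have CG': "C \<inter> G' \<subseteq> P \<or> C \<inter> G' \<subseteq> Q"
        using C(2) AB(1,2) PQ(1,2,4) G(2) by blast
      show ?thesis
      proof (cases "w \<in> C")
        case True
        have "conn E (C \<inter> G)"
          by (rule conn_piece[OF C(1) sym True CH G(2) no_edge])
        then have 1: "card (C \<inter> G) \<le> (card T + 1) div 2 \<and> (v \<in> C \<longrightarrow> card (C \<inter> G) \<le> card T div 2)"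
          using boundG[OF _ CG] G(3) by blast
        have "conn E (C \<inter> G')"
          by (rule conn_piece[OF C(1) sym True, of G' G]) (use CH G(2) no_edge' in blast)+
        then have 2: "card (C \<inter> G') \<le> card T' div 2"
          using boundG'[OF _ CG'] True wGG by blast
        have "card (C \<inter> G) + card (C \<inter> G') = card (C \<inter> G \<union> C \<inter> G') + card ((C \<inter> G) \<inter> (C \<inter> G'))"
          using finG by (intro card_Un_Int) auto
        moreover have "C \<inter> G \<union> C \<inter> G' = C" "(C \<inter> G) \<inter> (C \<inter> G') = {w}" using CH G(2) True by auto
        ultimately have "card (C \<inter> G) + card (C \<inter> G') = card C + 1" by simp
        \<comment> \<open>Since the two parts overlap in \<open>w\<close>, \<open>card C + 1\<close>
          is at most \<open>(card T + 1) div 2 + card T' div 2\<close>, hence at most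
          \<open>(card S + 3) div 2\<close>. If \<open>v\<close> is in \<open>C\<close>, both
          summands are rounded down and \<open>(card S + 2) div 2\<close> remains.\<close>
        then show ?thesis using 1 2 cardT by auto
      next
        case False
        have "C \<subseteq> G \<or> C \<subseteq> G'"
        proof (rule ccontr)
          assume *: "\<not> (C \<subseteq> G \<or> C \<subseteq> G')"
          then obtain x y where "x \<in> C \<inter> G" "y \<in> C - C \<inter> G" "E x y"
            using conn_exit[OF C(1), of "C \<inter> G"] CH by blast
          then show False using no_edge[of x y] CH False by blast
        qed
        then show ?thesis
        proof
          assume "C \<subseteq> G"
          then have "card C \<le> (card T + 1) div 2 \<and> (v \<in> C \<longrightarrow> card C \<le> card T div 2)"
            using boundG[OF C(1)] CG by (simp add: Int_absorb2)
          \<comment> \<open>The other terminal set has at least two elements, so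
            \<open>cardT\<close> yields \<open>card T \<le> card S\<close>.\<close>
          then show ?thesis using cardT two_T by auto
        next
          assume CG'': "C \<subseteq> G'"
          then have "card C \<le> (card T' + 1) div 2"
            using boundG'[OF C(1)] CG' by (simp add: Int_absorb2)
          moreover have "v \<notin> C"
          proof
            assume "v \<in> C"
            then have "v \<in> G \<inter> G'" using CG'' G(3) by blast
            then show False using G(2) False \<open>v \<in> C\<close> by simp
          qed
          ultimately show ?thesis using cardT two_T by auto
        qed
      qed
    qed
    have cover: "(A \<union> P) \<union> (B \<union> Q) = H" unfolding G(1)[symmetric] AB(1)[symmetric] PQ(1)[symmetric]
      by (simp only: Un_ac)
    show ?thesis
      by (rule exI[of _ "A \<union> P"], rule exI[of _ "B \<union> Q"], intro conjI cover disj conn_cut)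
        (intro allI impI bound; assumption)
  qed
qed

text \<open>Shrink \<open>C\<close> to an inclusion-minimal connected set containing
  \<open>S\<close> and cut that. With fewer than two prescribed vertices a single vertex is enough,
  and \<open>1 \<le> m\<close> makes room for it.\<close>

lemma connected_cut_through:
  assumes "finite C" and "conn E C" and "symp E" and "S \<subseteq> C" and "card S \<le> m" and "1 \<le> m"
  obtains A B where "A \<union> B \<subseteq> C" and "S \<subseteq> A \<union> B" and "A \<inter> B = {}" and "conn (cut_edge E A B) (A \<union> B)"
    and "conn_le E A ((m + 1) div 2)" and "conn_le E B ((m + 1) div 2)"
proof (cases "2 \<le> card S")
  case False
  have "finite S" using assms finite_subset by blast
  obtain v where v: "v \<in> C" "S \<subseteq> {v}"
  proof (cases "S = {}")
    case True
    then show ?thesis using assms that unfolding conn_def by blast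
  next
    case ne: False
    then have "card S = 1" using False \<open>finite S\<close> card_gt_0_iff[of S] by linarith
    then show ?thesis using that assms by (metis card_1_singletonE insert_subset order_refl)
  qed
  have "conn_le E {v} ((m + 1) div 2)" "conn_le E {} ((m + 1) div 2)"
    using conn_le_mono[OF conn_le_card[of "{v}" E]] conn_le_mono[OF conn_le_card[of "{}" E]] assms by auto
  then show ?thesis using v by (intro that[of "{v}" "{}"]) (auto simp: conn_singleton)
next
  case True
  define F where "F = {H. S \<subseteq> H \<and> H \<subseteq> C \<and> conn E H}"
  have "finite F" unfolding F_def using assms(1) by (auto intro: finite_subset[of _ "Pow C"])
  moreover have "F \<noteq> {}" unfolding F_def using assms by blast
  ultimately obtain H where H: "H \<in> F" "\<And>H'. H' \<in> F \<Longrightarrow> H' \<subseteq> H \<Longrightarrow> H' = H"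
    using finite_has_minimal[of F] by metis
  obtain v where v: "v \<in> S" using True by (cases "S = {}") auto
  have "\<exists>A B. A \<union> B = H \<and> A \<inter> B = {} \<and> conn (cut_edge E A B) H
    \<and> (\<forall>C. conn E C \<longrightarrow> C \<subseteq> A \<or> C \<subseteq> B \<longrightarrow>
         card C \<le> (card S + 1) div 2 \<and> (v \<in> C \<longrightarrow> card C \<le> card S div 2))"
  proof (rule minimal_connected_cut)
    show "finite H" using H(1) assms(1) finite_subset unfolding F_def by blast
    show "H' = H" if "S \<subseteq> H'" "H' \<subseteq> H" "conn E H'" for H'
      using that H(1) H(2)[of H'] unfolding F_def by blast
  qed (use H(1) assms(3) True v in \<open>auto simp: F_def\<close>)
  then obtain A B where AB: "A \<union> B = H" "A \<inter> B = {}" "conn (cut_edge E A B) H"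
    "conn_le E A ((card S + 1) div 2)" "conn_le E B ((card S + 1) div 2)"
    unfolding conn_le_def by blast
  moreover have "(card S + 1) div 2 \<le> (m + 1) div 2" using assms by auto
  ultimately show ?thesis using H unfolding F_def
    by (intro that[of A B]) (auto intro: conn_le_mono)
qed

text \<open>Among all admissible cuts take one covering the most vertices. An outside vertex of
  \<open>C\<close> with neighbours in one class only could enter the other class as an isolated
  vertex, and the cut would stay admissible.\<close>

lemma saturated_connected_cut:
  assumes "finite C" and "conn E C" and "symp E" and "S \<subseteq> C" and "card S \<le> m" and "1 \<le> m"
  obtains A B where "A \<union> B \<subseteq> C" and "S \<subseteq> A \<union> B" and "A \<inter> B = {}" and "conn (cut_edge E A B) (A \<union> B)"
    and "conn_le E A ((m + 1) div 2)" and "conn_le E B ((m + 1) div 2)"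
    and "\<And>v x. v \<in> C - (A \<union> B) \<Longrightarrow> x \<in> A \<union> B \<Longrightarrow> E v x \<Longrightarrow> (\<exists>a\<in>A. E v a) \<and> (\<exists>b\<in>B. E v b)"
proof -
  define good where "good A B \<longleftrightarrow> A \<union> B \<subseteq> C \<and> S \<subseteq> A \<union> B \<and> A \<inter> B = {} \<and> conn (cut_edge E A B) (A \<union> B)
    \<and> conn_le E A ((m + 1) div 2) \<and> conn_le E B ((m + 1) div 2)" for A B
  have commute: "good B A" if "good A B" for A B
    using that unfolding good_def by (auto simp: cut_edge_commute Un_commute)
  obtain A0 B0 where "good A0 B0"
    by (rule connected_cut_through[OF assms]) (rule that, unfold good_def, intro conjI, assumption+)
  then have "\<exists>A B. good A B \<and> card (A \<union> B) = card (A0 \<union> B0)" by blast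
  moreover have "n \<le> card C" if "\<exists>A B. good A B \<and> card (A \<union> B) = n" for n
    using that card_mono[OF assms(1)] unfolding good_def by blast
  ultimately have "\<exists>n. (\<exists>A B. good A B \<and> card (A \<union> B) = n)
      \<and> (\<forall>k. (\<exists>A B. good A B \<and> card (A \<union> B) = k) \<longrightarrow> k \<le> n)"
    by (intro Nat.ex_has_greatest_nat) auto
  then obtain A B where good: "good A B"
    and max: "\<And>A' B'. good A' B' \<Longrightarrow> card (A' \<union> B') \<le> card (A \<union> B)" by blast
  \<comment> \<open>Stated for any admissible pair with the same union, so that it also applies with
    the two classes exchanged.\<close>
  have sat: "\<exists>b\<in>B'. E v b"
    if "good A' B'" "A' \<union> B' = A \<union> B" "v \<in> C - (A' \<union> B')" "a \<in> A'" "E v a" for A' B' v a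
  proof (rule ccontr)
    assume "\<not> (\<exists>b\<in>B'. E v b)"
    then have "conn_le E (insert v B') ((m + 1) div 2)"
      using that assms unfolding good_def by (intro conn_le_insert_isolated) auto
    then have "good A' (insert v B')"
      using that assms conn_cut_insert[of E A' B' a v] unfolding good_def by auto
    then have "card (A' \<union> insert v B') \<le> card (A \<union> B)" by (rule max)
    moreover have "finite (A \<union> B)" using good assms(1) finite_subset unfolding good_def by blast
    ultimately show False using that by (simp add: card_insert_if)
  qed
  have "(\<exists>a\<in>A. E v a) \<and> (\<exists>b\<in>B. E v b)" if "v \<in> C - (A \<union> B)" "x \<in> A \<union> B" "E v x" for v x
    using that sat[OF good refl] sat[OF commute[OF good]] by (auto simp: Un_commute)
  then show ?thesis using good that unfolding good_def by metis
qed

section \<open>Odd clique minors\<close>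

text \<open>A connected spanning edge set that is minimal under inclusion is a tree.\<close>
lemma spanning_tree_of_cut:
  assumes "finite X" and "symp E" and "conn (cut_edge E A B) X" and "A \<inter> B = {}"
  obtains F where "tree_sub E X F" and "\<And>u v. {u, v} \<in> F \<Longrightarrow> (u \<in> A) \<noteq> (v \<in> A)"
proof -
  define full where "full = {{x, y} | x y. cut_edge E A B x y \<and> x \<in> X \<and> y \<in> X}"
  define N where "N = {F. F \<subseteq> full \<and> conn (\<lambda>x y. {x, y} \<in> F) X}"
  have "finite full"
    by (rule finite_subset[of _ "Pow X"]) (use assms(1) in \<open>auto simp: full_def\<close>)
  then have "finite N" unfolding N_def by (auto intro: finite_subset[of _ "Pow full"])
  moreover have "full \<in> N"
  proof -
    have "conn (\<lambda>x y. {x, y} \<in> full) X"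
      using assms(3) by (rule conn_mono_rel) (auto simp: full_def)
    then show ?thesis by (simp add: N_def)
  qed
  ultimately obtain F where F: "F \<in> N" "\<And>F'. F' \<in> N \<Longrightarrow> F' \<subseteq> F \<Longrightarrow> F' = F"
    using finite_has_minimal[of N] by (metis empty_iff)
  have edge: "cut_edge E A B u v \<and> u \<in> X \<and> v \<in> X" if "{u, v} \<in> F" for u v
  proof -
    have "{u, v} \<in> full" using that F unfolding N_def by blast
    then obtain x y where "{u, v} = {x, y}" "cut_edge E A B x y" "x \<in> X" "y \<in> X"
      unfolding full_def by blast
    then show ?thesis using symp_cut_edge[OF assms(2), of A B] by (auto simp: doubleton_eq_iff dest: sympD)
  qed
  \<comment> \<open>If an edge could be bypassed, every path using it could be rerouted, and
    removing the edge would leave a smaller connected edge set.\<close>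
  have acyclic: "\<not> reach (\<lambda>x y. {x, y} \<in> F - {{u, v}}) X u v" if uv: "{u, v} \<in> F" for u v
  proof
    let ?R = "\<lambda>x y. {x, y} \<in> F - {{u, v}}"
    assume 1: "reach ?R X u v"
    have "symp ?R" by (simp add: symp_def insert_commute)
    then have 2: "reach ?R X v u" using 1 by (rule reach_sym[rotated])
    have "reach ?R X x y" if "reach (\<lambda>x y. {x, y} \<in> F) X x y" for x y
      using that unfolding reach_def[of "\<lambda>x y. {x, y} \<in> F"]
    proof (induction rule: rtranclp_induct)
      case base
      then show ?case by (rule reach_refl)
    next
      case (step y z)
      have "reach ?R X y z"
      proof (cases "{y, z} = {u, v}")
        case True
        then show ?thesis using 1 2 by (auto simp: doubleton_eq_iff)
      next
        case False
        then show ?thesis using step by (intro reach_step[OF reach_refl]) auto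
      qed
      then show ?case by (rule reach_trans[OF step.IH])
    qed
    then have "conn ?R X" using F(1) by (simp add: N_def conn_def)
    then have "F - {{u, v}} \<in> N" using F(1) by (auto simp: N_def)
    then show False using F(2)[of "F - {{u, v}}"] uv by blast
  qed
  have "\<forall>e\<in>F. \<exists>u v. e = {u, v} \<and> E u v \<and> u \<in> X \<and> v \<in> X"
    using F(1) unfolding N_def full_def cut_edge_def by blast
  moreover have "conn (\<lambda>x y. {x, y} \<in> F) X" using F(1) by (simp add: N_def)
  ultimately have "tree_sub E X F" unfolding tree_sub_def using acyclic by simp
  moreover have "(u \<in> A) \<noteq> (v \<in> A)" if "{u, v} \<in> F" for u v
    using edge[OF that] assms(4) unfolding cut_edge_def by blast
  ultimately show ?thesis by (rule that)
qed

lemma tree_sub_edge: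
  assumes "tree_sub E X F" and "{u, v} \<in> F"
  shows "u \<in> X \<and> v \<in> X"
proof -
  have "\<forall>e\<in>F. \<exists>x y. e = {x, y} \<and> E x y \<and> x \<in> X \<and> y \<in> X"
    using assms(1) unfolding tree_sub_def by (rule conjunct1)
  then obtain x y where "{u, v} = {x, y}" "x \<in> X" "y \<in> X" using assms(2) by blast
  then show ?thesis by (auto simp: doubleton_eq_iff)
qed

text \<open>Colour each branch set by its classes: a spanning tree made of cut edges is properly
  coloured. For \<open>s < s'\<close> the vertex \<open>v\<close> sees both colours in piece
  \<open>s\<close>, so whichever colour it has, one of these edges is monochromatic.\<close>

lemma odd_minor_of_cuts:
  assumes "sgraph V E"
    and piece: "\<And>s. s \<in> {1..t} \<Longrightarrow> A s \<union> B s \<subseteq> V \<and> A s \<inter> B s = {} \<and> conn (cut_edge E (A s) (B s)) (A s \<union> B s)"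
    and disj: "\<And>s s'. s \<in> {1..t} \<Longrightarrow> s' \<in> {1..t} \<Longrightarrow> s \<noteq> s' \<Longrightarrow> (A s \<union> B s) \<inter> (A s' \<union> B s') = {}"
    and adj: "\<And>s s'. s \<in> {1..t} \<Longrightarrow> s' \<in> {1..t} \<Longrightarrow> s < s' \<Longrightarrow>
      \<exists>v\<in>A s' \<union> B s'. (\<exists>a\<in>A s. E v a) \<and> (\<exists>b\<in>B s. E v b)"
  shows "odd_minor V E t"
proof -
  have sym: "symp E" and fin: "finite V" using assms(1) unfolding sgraph_def symp_def by auto
  have "\<exists>F. tree_sub E (A s \<union> B s) F \<and> (\<forall>u v. {u, v} \<in> F \<longrightarrow> (u \<in> A s) \<noteq> (v \<in> A s))"
    if "s \<in> {1..t}" for s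
    using spanning_tree_of_cut[of "A s \<union> B s" E "A s" "B s"] piece[OF that] sym
      finite_subset[OF _ fin] by metis
  then obtain F where F: "\<And>s. s \<in> {1..t} \<Longrightarrow>
    tree_sub E (A s \<union> B s) (F s) \<and> (\<forall>u v. {u, v} \<in> F s \<longrightarrow> (u \<in> A s) \<noteq> (v \<in> A s))" by metis
  \<comment> \<open>One global colouring works because the pieces are disjoint: on piece
    \<open>s\<close> it is membership in \<open>A s\<close>.\<close>
  define c where "c x \<longleftrightarrow> (\<exists>s\<in>{1..t}. x \<in> A s)" for x
  have c: "c x \<longleftrightarrow> x \<in> A s" if "s \<in> {1..t}" "x \<in> A s \<union> B s" for x s
  proof
    assume "c x"
    then obtain s' where "s' \<in> {1..t}" "x \<in> A s'" unfolding c_def by blast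
    then show "x \<in> A s" using disj[of s s'] that by blast
  qed (use that in \<open>auto simp: c_def\<close>)
  have ex_p: "\<exists>q. fst q \<in> A s \<union> B s \<and> snd q \<in> A s' \<union> B s' \<and> E (fst q) (snd q) \<and> c (fst q) = c (snd q)"
    if s: "s \<in> {1..t}" "s' \<in> {1..t}" "s < s'" for s s'
  proof -
    obtain v a b where v: "v \<in> A s' \<union> B s'" "a \<in> A s" "E v a" "b \<in> B s" "E v b"
      using adj[OF s] by blast
    have "c a" "\<not> c b" using c[OF s(1)] v piece[OF s(1)] by auto
    then show ?thesis
      using v sym by (cases "c v") (auto intro: exI[of _ "(a, v)"] exI[of _ "(b, v)"] dest: sympD)
  qed
  define p where "p s s' = (SOME q. fst q \<in> A s \<union> B s \<and> snd q \<in> A s' \<union> B s'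
    \<and> E (fst q) (snd q) \<and> c (fst q) = c (snd q))" for s s'
  have p: "fst (p s s') \<in> A s \<union> B s \<and> snd (p s s') \<in> A s' \<union> B s' \<and> E (fst (p s s')) (snd (p s s'))
      \<and> c (fst (p s s')) = c (snd (p s s'))" if "s \<in> {1..t}" "s' \<in> {1..t}" "s < s'" for s s'
    unfolding p_def by (rule someI_ex[OF ex_p[OF that]])
  have colour: "c u \<noteq> c v" if "s \<in> {1..t}" "{u, v} \<in> F s" for s u v
    using F[OF that(1)] that(2) c[OF that(1)] tree_sub_edge[of E "A s \<union> B s" "F s" u v] by simp
  have trees: "\<forall>s\<in>{1..t}. A s \<union> B s \<subseteq> V \<and> tree_sub E (A s \<union> B s) (F s)
      \<and> (\<forall>u v. {u, v} \<in> F s \<longrightarrow> c u \<noteq> c v)"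
    using piece F colour by simp
  have disjoint: "\<forall>s\<in>{1..t}. \<forall>s'\<in>{1..t}. s \<noteq> s' \<longrightarrow> (A s \<union> B s) \<inter> (A s' \<union> B s') = {}"
    using disj by simp
  have edges: "\<forall>s\<in>{1..t}. \<forall>s'\<in>{1..t}. s < s' \<longrightarrow>
      fst (p s s') \<in> A s \<union> B s \<and> snd (p s s') \<in> A s' \<union> B s' \<and> E (fst (p s s')) (snd (p s s'))
      \<and> c (fst (p s s')) = c (snd (p s s'))"
    by (intro ballI impI p)
  show ?thesis
    unfolding odd_minor_def
    by (rule exI[of _ "\<lambda>s. A s \<union> B s"], rule exI[of _ F], rule exI[of _ p], rule exI[of _ c],
        intro conjI trees disjoint edges)
qed

section \<open>Building the decomposition\<close>

definition rest :: "'a set \<Rightarrow> (nat \<Rightarrow> 'a set) \<Rightarrow> nat \<Rightarrow> 'a set" where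
  "rest V H i = V - (\<Union>j\<in>{1..i}. H j)"

text \<open>Here \<open>m\<close> stands for \<open>t - 2\<close>, so \<open>(m + 1) div 2\<close>
  is \<open>\<lceil>(t - 2) / 2\<rceil>\<close>, and \<open>W\<close> is the set of vertices not yet
  covered.\<close>

definition good_piece :: "('a \<Rightarrow> 'a \<Rightarrow> bool) \<Rightarrow> nat \<Rightarrow> 'a set \<Rightarrow> 'a set \<Rightarrow> 'a set \<Rightarrow> bool" where
  "good_piece E m W A B \<longleftrightarrow> A \<inter> B = {} \<and> conn (cut_edge E A B) (A \<union> B)
     \<and> conn_le E A ((m + 1) div 2) \<and> conn_le E B ((m + 1) div 2)
     \<and> (\<forall>v\<in>W. adj E {v} (A \<union> B) \<longrightarrow> (\<exists>a\<in>A. E v a) \<and> (\<exists>b\<in>B. E v b))"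

definition clique_attached :: "('a \<Rightarrow> 'a \<Rightarrow> bool) \<Rightarrow> nat \<Rightarrow> 'a set \<Rightarrow> (nat \<Rightarrow> 'a set) \<Rightarrow> nat \<Rightarrow> bool" where
  "clique_attached E m W H i \<longleftrightarrow> (\<forall>C. component E W C \<longrightarrow>
     card {j\<in>{1..i}. adj E (H j) C} \<le> m
     \<and> (\<forall>j\<in>{1..i}. \<forall>k\<in>{1..i}. j \<noteq> k \<and> adj E (H j) C \<and> adj E (H k) C \<longrightarrow> adj E (H j) (H k)))"

text \<open>The pieces need not cover \<open>V\<close>, so a decomposition can be extended one piece
  at a time from \<open>l = 0\<close>.\<close>

definition decomp :: "'a set \<Rightarrow> ('a \<Rightarrow> 'a \<Rightarrow> bool) \<Rightarrow> nat \<Rightarrow> nat \<Rightarrow> (nat \<Rightarrow> 'a set) \<Rightarrow> bool" where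
  "decomp V E m l H \<longleftrightarrow> (\<forall>i\<in>{1..l}. H i \<subseteq> V)
     \<and> (\<forall>i\<in>{1..l}. \<forall>j\<in>{1..l}. i \<noteq> j \<longrightarrow> H i \<inter> H j = {})
     \<and> (\<forall>i\<in>{1..l}. (\<exists>A B. A \<union> B = H i \<and> good_piece E m (rest V H i) A B)
          \<and> clique_attached E m (rest V H i) H i)"

lemma adj_mono: "adj E S T \<Longrightarrow> S \<subseteq> S' \<Longrightarrow> T \<subseteq> T' \<Longrightarrow> adj E S' T'"
  unfolding adj_def by blast

lemma adj_commute: "symp E \<Longrightarrow> adj E S T \<longleftrightarrow> adj E T S"
  unfolding adj_def symp_def by blast

lemma good_piece_neighbours:
  assumes "good_piece E m W A B" and "v \<in> W" and "adj E {v} (A \<union> B)"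
  shows "(\<exists>a\<in>A. E v a) \<and> (\<exists>b\<in>B. E v b)"
  using assms unfolding good_piece_def by simp

text \<open>A vertex of a later piece that is adjacent to an earlier piece sees both of its classes,
  so some edge between the two pieces is monochromatic.\<close>
lemma odd_minor_of_clique:
  assumes G: "sgraph V E"
    and sub: "\<And>i. i \<in> {1..l} \<Longrightarrow> H i \<subseteq> V"
    and disj: "\<And>i j. i \<in> {1..l} \<Longrightarrow> j \<in> {1..l} \<Longrightarrow> i \<noteq> j \<Longrightarrow> H i \<inter> H j = {}"
    and piece: "\<And>i. i \<in> {1..l} \<Longrightarrow> \<exists>A B. A \<union> B = H i \<and> good_piece E m (rest V H i) A B"
    and C: "C \<subseteq> rest V H l" "conn E C"
    and J: "J \<subseteq> {1..l}" "card J = n" "\<And>j. j \<in> J \<Longrightarrow> adj E (H j) C"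
    and clique: "\<And>j k. j \<in> J \<Longrightarrow> k \<in> J \<Longrightarrow> j \<noteq> k \<Longrightarrow> adj E (H j) (H k)"
  shows "odd_minor V E (n + 1)"
proof -
  have sym: "symp E" and fin: "finite V" using G unfolding sgraph_def symp_def by auto
  obtain A B where AB: "\<And>i. i \<in> {1..l} \<Longrightarrow> A i \<union> B i = H i \<and> good_piece E m (rest V H i) (A i) (B i)"
    using piece by metis
  have CV: "C \<subseteq> V" using C unfolding rest_def by blast
  obtain P Q where PQ: "P \<union> Q = C" "P \<inter> Q = {}" "conn (cut_edge E P Q) C"
    using connected_cut_exists[OF finite_subset[OF CV fin] C(2) sym] by blast
  have "finite J" using J(1) finite_subset by blast
  then obtain h where h: "bij_betw h {..<n} J" "strict_mono_on {..<n} h"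
    using ex_bij_betw_strict_mono_card[of J] J(2) by metis
  \<comment> \<open>The pieces from \<open>J\<close> come first in increasing order and
    \<open>C\<close> last, at index \<open>n + 1\<close>. The order matters: only vertices of later
    sets are known to see both classes of an earlier piece. The shift \<open>s - 1\<close> appears
    because \<open>h\<close> counts from 0.\<close>
  define A' where "A' s = (if s = n + 1 then P else A (h (s - 1)))" for s
  define B' where "B' s = (if s = n + 1 then Q else B (h (s - 1)))" for s
  have hJ: "h (s - 1) \<in> J" if "s \<in> {1..n + 1}" "s \<noteq> n + 1" for s
    using that h(1) by (auto simp: bij_betw_def)
  have hl: "h (s - 1) \<in> {1..l}" if "s \<in> {1..n + 1}" "s \<noteq> n + 1" for s
    using hJ[OF that] J(1) by blast
  have h_less: "h (s - 1) < h (s' - 1)" if "s \<in> {1..n + 1}" "s < s'" "s' \<le> n" for s s'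
    using that by (intro strict_mono_onD[OF h(2)]) auto
  have X: "A' s \<union> B' s = (if s = n + 1 then C else H (h (s - 1)))" if "s \<in> {1..n + 1}" for s
    using AB[OF hl[OF that]] PQ(1) unfolding A'_def B'_def by auto
  have CH: "C \<inter> H i = {}" if "i \<in> {1..l}" for i
    using C(1) that unfolding rest_def by blast
  have disj': "(A' s \<union> B' s) \<inter> (A' s' \<union> B' s') = {}"
    if "s \<in> {1..n + 1}" "s' \<in> {1..n + 1}" "s < s'" for s s'
  proof (cases "s' = n + 1")
    case True
    then show ?thesis using X[OF that(1)] X[OF that(2)] CH[OF hl[OF that(1)]] that by auto
  next
    case False
    then have "h (s - 1) < h (s' - 1)" using h_less that by auto
    then show ?thesis
      using X[OF that(1)] X[OF that(2)] disj[OF hl[OF that(1)] hl[OF that(2) False]] that False by auto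
  qed
  show ?thesis
  proof (rule odd_minor_of_cuts[OF G, of _ A' B'])
    fix s assume s: "s \<in> {1..n + 1}"
    show "A' s \<union> B' s \<subseteq> V \<and> A' s \<inter> B' s = {} \<and> conn (cut_edge E (A' s) (B' s)) (A' s \<union> B' s)"
    proof (cases "s = n + 1")
      case True
      then show ?thesis using PQ CV by (simp add: A'_def B'_def)
    next
      case False
      then show ?thesis
        using AB[OF hl[OF s False]] sub[OF hl[OF s False]] by (auto simp: A'_def B'_def good_piece_def)
    qed
  next
    fix s s' assume "s \<in> {1..n + 1}" "s' \<in> {1..n + 1}" "s \<noteq> s'"
    then show "(A' s \<union> B' s) \<inter> (A' s' \<union> B' s') = {}"
      using disj'[of s s'] disj'[of s' s] by (metis Int_commute nat_neq_iff)
  next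
    fix s s' assume s: "s \<in> {1..n + 1}" and s': "s' \<in> {1..n + 1}" and less: "s < s'"
    have sn: "s \<noteq> n + 1" using less s' by auto
    let ?i = "h (s - 1)"
    note i = hl[OF s sn]
    \<comment> \<open>The set with the later index avoids all pieces up to \<open>?i\<close>, so its
      vertices fall under the neighbour condition of piece \<open>?i\<close>.\<close>
    have *: "adj E (H ?i) (A' s' \<union> B' s') \<and> A' s' \<union> B' s' \<subseteq> rest V H ?i"
    proof (cases "s' = n + 1")
      case True
      have "rest V H l \<subseteq> rest V H ?i" using i unfolding rest_def by auto
      then show ?thesis using True X[OF s'] J(3)[OF hJ[OF s sn]] C(1) by auto
    next
      case False
      let ?k = "h (s' - 1)"
      have "?i < ?k" using False h_less[OF s less] s' by auto
      moreover have "H ?k \<inter> H j = {}" if "j \<in> {1..?i}" for j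
        using disj[OF hl[OF s' False], of j] that \<open>?i < ?k\<close> i by auto
      then have "H ?k \<subseteq> rest V H ?i" using sub[OF hl[OF s' False]] unfolding rest_def by blast
      moreover have "adj E (H ?i) (H ?k)"
        using clique[OF hJ[OF s sn] hJ[OF s' False]] \<open>?i < ?k\<close> by auto
      ultimately show ?thesis using False X[OF s'] by simp
    qed
    then obtain v where v: "v \<in> A' s' \<union> B' s'" "adj E {v} (H ?i)"
      using sym unfolding adj_def by (blast dest: sympD)
    then show "\<exists>v\<in>A' s' \<union> B' s'. (\<exists>a\<in>A' s. E v a) \<and> (\<exists>b\<in>B' s. E v b)"
    proof (intro bexI[OF _ v(1)])
      have "v \<in> rest V H ?i" using * v(1) by blast
      moreover have "adj E {v} (A ?i \<union> B ?i)" using AB[OF i] v(2) by simp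
      ultimately have "(\<exists>a\<in>A ?i. E v a) \<and> (\<exists>b\<in>B ?i. E v b)"
        using good_piece_neighbours AB[OF i] by metis
      then show "(\<exists>a\<in>A' s. E v a) \<and> (\<exists>b\<in>B' s. E v b)"
        using sn by (simp add: A'_def B'_def)
    qed
  qed
qed

text \<open>The new piece is a saturated cut inside a component \<open>C\<close> of the remainder,
  through a neighbour of each old piece adjacent to \<open>C\<close>. A new component either is not
  adjacent to the new piece and was a component before, or lies in \<open>C\<close>, and then every
  old piece attached to it is adjacent to the new one.\<close>

lemma decomp_extend:
  assumes G: "sgraph V E" and "1 \<le> m" and no_minor: "\<not> odd_minor V E (m + 2)"
    and dec: "decomp V E m l H" and "rest V H l \<noteq> {}"
  obtains H' where "decomp V E m (Suc l) H'" and "rest V H' (Suc l) \<subset> rest V H l"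
proof -
  have sym: "symp E" and fin: "finite V" using G unfolding sgraph_def symp_def by auto
  let ?W = "rest V H l"
  have WV: "?W \<subseteq> V" unfolding rest_def by blast
  obtain x where "x \<in> ?W" using assms by blast
  then obtain C where C: "component E ?W C" using component_exists sym by metis
  then have CW: "C \<subseteq> ?W" and conC: "conn E C" unfolding component_def by auto
  \<comment> \<open>\<open>decomp\<close> records attachment only for indices from 1 on; with no
    pieces the condition is vacuous.\<close>
  have old: "clique_attached E m ?W H l"
  proof (cases "l = 0")
    case True
    then show ?thesis by (simp add: clique_attached_def)
  next
    case False
    then show ?thesis using dec unfolding decomp_def by simp
  qed
  define J where "J = {j\<in>{1..l}. adj E (H j) C}"
  have "card J \<le> m" using old C unfolding clique_attached_def J_def by blast
  have "\<exists>x\<in>C. adj E (H j) {x}" if "j \<in> J" for j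
    using that unfolding J_def adj_def by blast
  \<comment> \<open>These at most \<open>m\<close> vertices are the terminals of the cut; containing
    them makes the new piece adjacent to every piece indexed by \<open>J\<close>.\<close>
  then obtain f where f: "\<And>j. j \<in> J \<Longrightarrow> f j \<in> C \<and> adj E (H j) {f j}" by metis
  have "finite J" unfolding J_def by simp
  then have card_f: "card (f ` J) \<le> m" using card_image_le[of J f] \<open>card J \<le> m\<close> by linarith
  have f_C: "f ` J \<subseteq> C" using f by blast
  have fin_C: "finite C" using finite_subset[OF subset_trans[OF CW WV] fin] .
  obtain A B where AB: "A \<union> B \<subseteq> C" "f ` J \<subseteq> A \<union> B" "A \<inter> B = {}"
    "conn (cut_edge E A B) (A \<union> B)" "conn_le E A ((m + 1) div 2)" "conn_le E B ((m + 1) div 2)"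
    and sat: "\<And>v x. v \<in> C - (A \<union> B) \<Longrightarrow> x \<in> A \<union> B \<Longrightarrow> E v x \<Longrightarrow> (\<exists>a\<in>A. E v a) \<and> (\<exists>b\<in>B. E v b)"
    by (rule saturated_connected_cut[OF fin_C conC sym f_C card_f assms(2)]) (rule that, assumption+)
  define X where "X = A \<union> B"
  define H' where "H' = H(Suc l := X)"
  have H'_old: "H' j = H j" if "j \<le> l" for j using that by (simp add: H'_def)
  have H'_new: "H' (Suc l) = X" by (simp add: H'_def)
  have conX: "conn E X" using conn_cut_conn[OF AB(4)] by (simp add: X_def)
  then have "X \<noteq> {}" unfolding conn_def by blast
  have XC: "X \<subseteq> C" and XW: "X \<subseteq> ?W" using AB CW by (auto simp: X_def)
  have rest_old: "rest V H' i = rest V H i" if "i \<le> l" for i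
    using that unfolding rest_def by (auto simp: H'_old)
  have rest_new: "rest V H' (Suc l) = ?W - X"
    unfolding rest_def using H'_old H'_new by (auto simp: atLeastAtMostSuc_conv)
  have att_old: "clique_attached E m W H' i \<longleftrightarrow> clique_attached E m W H i" if "i \<le> l" for i W
  proof -
    have "{j\<in>{1..i}. adj E (H' j) D} = {j\<in>{1..i}. adj E (H j) D}" for D
      using that by (auto simp: H'_old)
    then show ?thesis unfolding clique_attached_def using that by (simp add: H'_old)
  qed
  have good: "good_piece E m (rest V H' (Suc l)) A B"
  proof -
    have "(\<exists>a\<in>A. E v a) \<and> (\<exists>b\<in>B. E v b)" if v: "v \<in> ?W - X" "adj E {v} (A \<union> B)" for v
    proof -
      obtain x where x: "x \<in> A \<union> B" "E v x" using v(2) unfolding adj_def by blast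
      \<comment> \<open>An uncovered neighbour of the new piece cannot leave the component
        \<open>C\<close>, so saturation inside \<open>C\<close> suffices.\<close>
      then have "v \<in> C" using C AB(1) v(1) sym unfolding component_def by (blast dest: sympD)
      then show ?thesis using sat[OF _ x] v(1) by (simp add: X_def)
    qed
    then show ?thesis unfolding good_piece_def rest_new using AB by blast
  qed
  have sub': "H' i \<subseteq> V" if "i \<in> {1..Suc l}" for i
    using that dec H'_old H'_new XW WV unfolding decomp_def by (cases "i = Suc l") auto
  have XH: "X \<inter> H j = {}" if "j \<in> {1..l}" for j
    using that XW unfolding rest_def by blast
  have disj': "H' i \<inter> H' j = {}" if "i \<in> {1..Suc l}" "j \<in> {1..Suc l}" "i \<noteq> j" for i j
    using that dec H'_old H'_new XH[of i] XH[of j] unfolding decomp_def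
    by (cases "i = Suc l"; cases "j = Suc l") (auto simp: Int_commute)
  have piece': "\<exists>A B. A \<union> B = H' i \<and> good_piece E m (rest V H' i) A B" if "i \<in> {1..Suc l}" for i
  proof (cases "i = Suc l")
    case True
    then show ?thesis using good H'_new unfolding X_def by blast
  next
    case False
    then show ?thesis using that dec H'_old[of i] rest_old[of i] unfolding decomp_def by auto
  qed
  have "card {j\<in>{1..Suc l}. adj E (H' j) D} \<le> m \<and>
    (\<forall>j\<in>{1..Suc l}. \<forall>k\<in>{1..Suc l}. j \<noteq> k \<and> adj E (H' j) D \<and> adj E (H' k) D \<longrightarrow> adj E (H' j) (H' k))"
    if D: "component E (?W - X) D" for D
  proof (cases "adj E X D")
    case False
    \<comment> \<open>No edge joins \<open>D\<close> to \<open>X\<close>, so putting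
      \<open>X\<close> back does not enlarge \<open>D\<close>.\<close>
    then have "component E ?W D"
      using D sym unfolding component_def adj_def by (blast dest: sympD)
    moreover have "{j\<in>{1..Suc l}. adj E (H' j) D} = {j\<in>{1..l}. adj E (H j) D}"
      using False H'_old H'_new by (auto simp: le_Suc_eq)
    moreover have old_index: "j \<in> {1..l} \<and> H' j = H j" if "j \<in> {1..Suc l}" "adj E (H' j) D" for j
      using that False H'_old H'_new by (auto simp: le_Suc_eq)
    moreover have "adj E (H' j) (H' k)"
      if "j \<in> {1..Suc l}" "k \<in> {1..Suc l}" "j \<noteq> k" "adj E (H' j) D" "adj E (H' k) D" for j k
      using old \<open>component E ?W D\<close> that old_index[OF that(1,4)] old_index[OF that(2,5)]
      unfolding clique_attached_def by metis
    ultimately show ?thesis using old unfolding clique_attached_def by metis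
  next
    case True
    have DW: "D \<subseteq> ?W - X" and conD: "conn E D" using D unfolding component_def by auto
    obtain d x where d: "d \<in> D" "x \<in> X" "E x d" using True unfolding adj_def by blast
    then have "d \<in> C" using C XC DW unfolding component_def by blast
    then have DC: "D \<subseteq> C" using conn_subset_component[OF C conD] DW d by blast
    have X_adj: "adj E X (H j)" if "j \<in> {1..l}" "adj E (H j) D" for j
    proof -
      have "j \<in> J" using that DC unfolding J_def by (auto elim: adj_mono)
      then have "adj E (H j) {f j}" "f j \<in> X" using f AB(2) unfolding X_def by auto
      then have "adj E (H j) X" by (auto elim: adj_mono)
      then show ?thesis using adj_commute[OF sym] by blast
    qed
    have clique': "adj E (H' j) (H' k)"
      if jk: "j \<in> {1..Suc l}" "k \<in> {1..Suc l}" "j \<noteq> k" "adj E (H' j) D" "adj E (H' k) D" for j k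
    proof -
      consider "j = Suc l" "k \<in> {1..l}" | "k = Suc l" "j \<in> {1..l}" | "j \<in> {1..l}" "k \<in> {1..l}"
        using jk by (auto simp: le_Suc_eq)
      then show ?thesis
      proof cases
        case 1
        then show ?thesis using jk X_adj[of k] H'_old H'_new by auto
      next
        case 2
        then show ?thesis using jk X_adj[of j] H'_old H'_new adj_commute[OF sym] by auto
      next
        case 3
        then have "adj E (H j) C" "adj E (H k) C"
          using jk DC H'_old by (auto elim: adj_mono)
        then show ?thesis using 3 jk old C H'_old unfolding clique_attached_def by auto
      qed
    qed
    moreover have "card {j\<in>{1..Suc l}. adj E (H' j) D} \<le> m"
    proof (rule ccontr)
      assume "\<not> ?thesis"
      \<comment> \<open>These \<open>m + 1\<close> pairwise adjacent pieces, all attached to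
        \<open>D\<close>, would form together with \<open>D\<close> the \<open>m + 2\<close> branch
        sets of an odd minor.\<close>
      then obtain K where K: "K \<subseteq> {j\<in>{1..Suc l}. adj E (H' j) D}" "card K = m + 1"
        using obtain_subset_with_card_n[of "m + 1"] by (metis Suc_eq_plus1 not_less_eq_eq)
      have "odd_minor V E (m + 1 + 1)"
      proof (rule odd_minor_of_clique[OF G sub' disj' piece' _ conD _ K(2)])
        show "D \<subseteq> rest V H' (Suc l)" using DW rest_new by simp
      qed (use K(1) clique' in auto)
      then show False using no_minor by simp
    qed
    ultimately show ?thesis by blast
  qed
  then have "clique_attached E m (rest V H' (Suc l)) H' (Suc l)"
    unfolding clique_attached_def rest_new by blast
  then have attach': "clique_attached E m (rest V H' i) H' i" if "i \<in> {1..Suc l}" for i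
    using that dec att_old[of i] rest_old[of i] unfolding decomp_def by (cases "i = Suc l") auto
  have "decomp V E m (Suc l) H'"
    unfolding decomp_def by (intro conjI ballI impI sub' disj' piece' attach')
  moreover have "rest V H' (Suc l) \<subset> ?W" using rest_new XW \<open>X \<noteq> {}\<close> by blast
  ultimately show ?thesis by (rule that)
qed

text \<open>Start without pieces; each extension strictly shrinks the finite remainder.\<close>

lemma decomp_exhausting:
  assumes "sgraph V E" and "1 \<le> m" and "\<not> odd_minor V E (m + 2)"
  obtains l H where "decomp V E m l H" and "rest V H l = {}"
proof -
  have exhaust: "\<exists>l H. decomp V E m l H \<and> rest V H l = {}" if "decomp V E m l H" for l H
    using that
  proof (induction "card (rest V H l)" arbitrary: l H rule: less_induct)
    case less
    show ?case
    proof (cases "rest V H l = {}")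
      case False
      obtain H' where H': "decomp V E m (Suc l) H'" "rest V H' (Suc l) \<subset> rest V H l"
        using decomp_extend[OF assms less.prems False] by blast
      have "finite (rest V H l)" using assms(1) unfolding sgraph_def rest_def by simp
      then show ?thesis using less.hyps[OF psubset_card_mono[OF _ H'(2)] H'(1)] by blast
    qed (use less in blast)
  qed
  have "decomp V E m 0 (\<lambda>_. {})" by (simp add: decomp_def)
  from exhaust[OF this] show ?thesis by (elim exE conjE) (rule that)
qed

section \<open>Rounding and the final statement\<close>

lemma nat_ceiling_half: "nat \<lceil>real n / 2\<rceil> = (n + 1) div 2"
proof (cases "even n")
  case True
  then show ?thesis by (auto elim!: evenE)
next
  case False
  then obtain k where k: "n = 2 * k + 1" by (rule oddE)
  have "\<lceil>real n / 2\<rceil> = int k + 1" by (rule ceiling_unique) (use k in auto)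
  then show ?thesis using k by simp
qed

theorem theorem3:
  fixes V :: "'a set" and E :: "'a \<Rightarrow> 'a \<Rightarrow> bool" and t :: nat
  assumes "sgraph V E" and "t \<ge> 3" and "conn E V" and "\<not> odd_minor V E t"
  shows "\<exists>(l :: nat) (H :: nat \<Rightarrow> 'a set).
    (\<forall>i\<in>{1..l}. H i \<subseteq> V \<and> conn E (H i))
  \<and> (\<forall>i\<in>{1..l}. \<forall>j\<in>{1..l}. i \<noteq> j \<longrightarrow> H i \<inter> H j = {})
  \<and> (\<Union>i\<in>{1..l}. H i) = V
  \<and> (\<forall>i\<in>{1..l}.
       (\<exists>A B. A \<union> B = H i \<and> A \<inter> B = {}
          \<and> (\<forall>C. component E A C \<longrightarrow> card C \<le> nat \<lceil>(real t - 2) / 2\<rceil>)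
          \<and> (\<forall>C. component E B C \<longrightarrow> card C \<le> nat \<lceil>(real t - 2) / 2\<rceil>)
          \<and> conn (\<lambda>x y. E x y \<and> (x \<in> A \<and> y \<in> B \<or> x \<in> B \<and> y \<in> A)) (H i)
          \<and> (\<forall>v \<in> V - (\<Union>j\<in>{1..i}. H j). adj E {v} (H i) \<longrightarrow>
               (\<exists>a\<in>A. E v a) \<and> (\<exists>b\<in>B. E v b)))
     \<and> (\<forall>C. component E (V - (\<Union>j\<in>{1..i}. H j)) C \<longrightarrow>
          card {j\<in>{1..i}. adj E (H j) C} \<le> t - 2
          \<and> (\<forall>j\<in>{1..i}. \<forall>k\<in>{1..i}. j \<noteq> k \<and> adj E (H j) C \<and> adj E (H k) C
                \<longrightarrow> adj E (H j) (H k))))"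
proof -
  let ?m = "t - 2"
  have m: "1 \<le> ?m" "t = ?m + 2" using assms(2) by auto
  then have "\<not> odd_minor V E (?m + 2)" using assms(4) by simp
  then obtain l H where dec: "decomp V E ?m l H" and "rest V H l = {}"
    using decomp_exhausting[OF assms(1) m(1)] by blast
  have sub: "H i \<subseteq> V" and disj: "\<And>j. j \<in> {1..l} \<Longrightarrow> i \<noteq> j \<Longrightarrow> H i \<inter> H j = {}"
    and attach: "clique_attached E ?m (rest V H i) H i"
    and piece: "\<exists>A B. A \<union> B = H i \<and> good_piece E ?m (rest V H i) A B" if "i \<in> {1..l}" for i
    using dec that unfolding decomp_def by blast+
  have cover: "(\<Union>i\<in>{1..l}. H i) = V"
    using sub \<open>rest V H l = {}\<close> unfolding rest_def by blast
  have conn: "conn E (H i)" if "i \<in> {1..l}" for i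
    using piece[OF that] conn_cut_conn unfolding good_piece_def by metis
  \<comment> \<open>As \<open>t \<ge> 3\<close>, the truncated difference \<open>t - 2\<close>
    agrees with the real one.\<close>
  have half: "(real t - 2) / 2 = real ?m / 2" using assms(2) by (simp add: of_nat_diff)
  have bound: "\<forall>C. component E X C \<longrightarrow> card C \<le> nat \<lceil>(real t - 2) / 2\<rceil>"
    if "conn_le E X ((?m + 1) div 2)" for X
    using that unfolding half nat_ceiling_half conn_le_def component_def by blast
  have pieces: "\<exists>A B. A \<union> B = H i \<and> A \<inter> B = {}
          \<and> (\<forall>C. component E A C \<longrightarrow> card C \<le> nat \<lceil>(real t - 2) / 2\<rceil>)
          \<and> (\<forall>C. component E B C \<longrightarrow> card C \<le> nat \<lceil>(real t - 2) / 2\<rceil>)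
          \<and> conn (\<lambda>x y. E x y \<and> (x \<in> A \<and> y \<in> B \<or> x \<in> B \<and> y \<in> A)) (H i)
          \<and> (\<forall>v \<in> V - (\<Union>j\<in>{1..i}. H j). adj E {v} (H i) \<longrightarrow>
               (\<exists>a\<in>A. E v a) \<and> (\<exists>b\<in>B. E v b))" if i: "i \<in> {1..l}" for i
  proof -
    obtain A B where AB: "A \<union> B = H i" "good_piece E ?m (rest V H i) A B" using piece[OF i] by blast
    then have "A \<inter> B = {}" "conn_le E A ((?m + 1) div 2)" "conn_le E B ((?m + 1) div 2)"
      "conn (cut_edge E A B) (H i)"
      "\<forall>v\<in>rest V H i. adj E {v} (H i) \<longrightarrow> (\<exists>a\<in>A. E v a) \<and> (\<exists>b\<in>B. E v b)"
      unfolding good_piece_def by simp_all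
    then show ?thesis
      unfolding rest_def cut_edge_def
      by (intro exI[of _ A] exI[of _ B] conjI bound AB(1))
  qed
  have sub_conn: "\<forall>i\<in>{1..l}. H i \<subseteq> V \<and> conn E (H i)"
    using sub conn by simp
  have disjoint: "\<forall>i\<in>{1..l}. \<forall>j\<in>{1..l}. i \<noteq> j \<longrightarrow> H i \<inter> H j = {}"
    using disj by simp
  have later: "\<forall>C. component E (V - (\<Union>j\<in>{1..i}. H j)) C \<longrightarrow>
          card {j\<in>{1..i}. adj E (H j) C} \<le> t - 2
          \<and> (\<forall>j\<in>{1..i}. \<forall>k\<in>{1..i}. j \<noteq> k \<and> adj E (H j) C \<and> adj E (H k) C
                \<longrightarrow> adj E (H j) (H k))" if "i \<in> {1..l}" for i
    using attach[OF that] unfolding clique_attached_def rest_def .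
  show ?thesis
    by (rule exI[of _ l], rule exI[of _ H], intro conjI sub_conn disjoint cover,
        rule ballI, rule conjI[OF pieces later])
qed

end
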